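(* Let $d\ge 2$ and let $\rho$ be any density matrix on $\mathcal{H}_d=\mathbb{C}^d$. Then $$C_G(\rho)\ge\max[1-d(1-K),\,0],$$ where $K=\langle\Psi_d|\rho|\Psi_d\rangle$ and $|\Psi_d\rangle=\frac{1}{\sqrt d}\sum_{i=1}^d|i\rangle$.
   Context: Fix the reference orthonormal basis $\{|i\rangle\}_{i=1,\dots,d}$ of $\mathcal{H}_d=\mathbb{C}^d$. The G-coherence measure of a pure state (unit vector) $|\psi\rangle=\sum_{i=1}^d a_i|i\rangle$ is $C_G(|\psi\rangle)=d|a_1a_2\cdots a_d|^{2/d}$. For a density matrix $\rho$ it is defined by the convex roof $C_G(\rho)=\min_{\{p_i,|\psi_i\rangle\}}\sum_i p_i C_G(|\psi_i\rangle)$, the minimum running over all (finite) pure-state decompositions $\rho=\sum_i p_i|\psi_i\rangle\langle\psi_i|$ with $p_i\ge 0$, $\sum_i p_i=1$. *)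

theory Defs
  imports "HOL-Analysis.Analysis"
begin

text \<open>Vectors of \<open>\<complex>\<^sup>d\<close> are rendered as \<^typ>\<open>complex ^ 'n\<close> with \<open>d = CARD('n)\<close>; the reference basis
  is the standard one, so \<open>\<psi> $ i\<close> is the amplitude \<open>a\<^sub>i\<close>. The library norm on this type is the
  Hilbert-space norm.\<close>

definition cinner :: "complex ^ 'n \<Rightarrow> complex ^ 'n \<Rightarrow> complex" where
  "cinner \<phi> \<psi> = (\<Sum>i\<in>UNIV. cnj (\<phi> $ i) * \<psi> $ i)"

lemma norm_eq_cinner: "complex_of_real ((norm \<psi>)\<^sup>2) = cinner \<psi> \<psi>"
  unfolding cinner_def
  by (simp add: norm_vec_def L2_set_def sum_nonneg complex_norm_square mult.commute
      del: of_real_power)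

definition hermitian :: "complex ^ 'n ^ 'n \<Rightarrow> bool" where
  "hermitian A \<longleftrightarrow> (\<forall>i j. A $ i $ j = cnj (A $ j $ i))"

lemma hermitian_cinner_real:
  assumes "hermitian A"
  shows "cinner v (A *v v) \<in> \<real>"
proof -
  have "cnj (cinner v (A *v v)) = (\<Sum>i\<in>UNIV. \<Sum>j\<in>UNIV. v $ i * (cnj (A $ i $ j) * cnj (v $ j)))"
    by (simp add: cinner_def matrix_vector_mult_def sum_distrib_left)
  also have "\<dots> = (\<Sum>i\<in>UNIV. \<Sum>j\<in>UNIV. v $ i * (A $ j $ i * cnj (v $ j)))"
    using assms by (intro sum.cong refl) (metis complex_cnj_cnj hermitian_def)
  also have "\<dots> = (\<Sum>j\<in>UNIV. \<Sum>i\<in>UNIV. v $ i * (A $ j $ i * cnj (v $ j)))"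
    by (rule sum.swap)
  also have "\<dots> = cinner v (A *v v)"
    by (simp add: cinner_def matrix_vector_mult_def sum_distrib_left mult_ac)
  finally show ?thesis
    by (simp add: Reals_cnj_iff)
qed

text \<open>By the preceding lemma \<open>\<langle>v|\<rho>|v\<rangle>\<close> is real for Hermitian \<open>\<rho>\<close>, so taking real parts
  loses nothing.\<close>

definition density_matrix :: "complex ^ 'n ^ 'n \<Rightarrow> bool" where
  "density_matrix \<rho> \<longleftrightarrow>
     hermitian \<rho> \<and> (\<forall>v. 0 \<le> Re (cinner v (\<rho> *v v))) \<and> trace \<rho> = 1"

definition pure_state :: "complex ^ 'n \<Rightarrow> bool" where
  "pure_state \<psi> \<longleftrightarrow> norm \<psi> = 1"

definition ketbra :: "complex ^ 'n \<Rightarrow> complex ^ 'n ^ 'n" where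
  "ketbra \<psi> = (\<chi> i j. \<psi> $ i * cnj (\<psi> $ j))"

definition pure_decomposition ::
  "complex ^ 'n ^ 'n \<Rightarrow> nat \<Rightarrow> (nat \<Rightarrow> real) \<Rightarrow> (nat \<Rightarrow> complex ^ 'n) \<Rightarrow> bool" where
  "pure_decomposition \<rho> m p \<psi> \<longleftrightarrow>
     (\<forall>k<m. 0 \<le> p k \<and> pure_state (\<psi> k)) \<and> (\<Sum>k<m. p k) = 1 \<and>
     \<rho> = (\<Sum>k<m. p k *\<^sub>R ketbra (\<psi> k))"

definition roof_values :: "(complex ^ 'n \<Rightarrow> real) \<Rightarrow> complex ^ 'n ^ 'n \<Rightarrow> real set" where
  "roof_values C \<rho> = {\<Sum>k<m. p k * C (\<psi> k) |m p \<psi>. pure_decomposition \<rho> m p \<psi>}"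

text \<open>The infimum is the minimum whenever the latter exists, which is the case for
  continuous \<open>C\<close> and density matrices \<open>\<rho>\<close> (compactness).\<close>

definition convex_roof :: "(complex ^ 'n \<Rightarrow> real) \<Rightarrow> complex ^ 'n ^ 'n \<Rightarrow> real" where
  "convex_roof C \<rho> = Inf (roof_values C \<rho>)"

lemma convex_roof_eq_minimum:
  assumes "v \<in> roof_values C \<rho>" and "\<And>w. w \<in> roof_values C \<rho> \<Longrightarrow> v \<le> w"
  shows "convex_roof C \<rho> = v"
  unfolding convex_roof_def using assms by (rule cInf_eq_minimum)

definition G_coherence_pure :: "complex ^ 'n \<Rightarrow> real" where
  "G_coherence_pure \<psi> =
     real CARD('n) * cmod (\<Prod>i\<in>UNIV. \<psi> $ i) powr (2 / real CARD('n))"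

definition G_coherence :: "complex ^ 'n ^ 'n \<Rightarrow> real" where
  "G_coherence \<rho> = convex_roof G_coherence_pure \<rho>"

definition max_coherent :: "complex ^ 'n" where
  "max_coherent = (\<chi> i. complex_of_real (1 / sqrt (real CARD('n))))"

end

theory Submission
  imports Defs
begin

text \<open>
  For a pure state with amplitudes of modulus \<open>x\<^sub>i\<close> the bound is Kober's inequality
  \<open>(d - 1) \<Sum> x\<^sub>i\<^sup>2 + d (\<Prod> x\<^sub>i)\<^bsup>2/d\<^esup> \<ge> (\<Sum> x\<^sub>i)\<^sup>2\<close>, which follows by induction on the number of
  variables by splitting off the smallest one and applying AM-GM. Since \<open>K\<close> is affine in \<open>\<rho>\<close>,
  the bound passes to every average over a pure-state decomposition. For the infimum to inherit
  it, a decomposition must exist; iterated Schur complements (Cholesky) provide one.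
\<close>

section \<open>Kober's inequality\<close>

text \<open>Here \<open>S\<close>, \<open>Q\<close> and \<open>P\<close> stand for the sum, the sum
  of squares and the product of the \<open>m\<close> larger variables, \<open>t\<close> for the
  smallest. With \<open>g = P powr (1 / m)\<close>, the cross term splits as
  \<open>2 * t * S = 2 * t * (S - m * g) + 2 * m * t * g\<close>. The first summand is at most
  \<open>Q - m * g\<^sup>2\<close>, the second is bounded by weighted AM-GM, and \<open>IH\<close>
  accounts for \<open>S\<^sup>2\<close>.\<close>

lemma Kober_step:
  fixes t P Q S :: real and m :: nat
  assumes m: "m \<ge> 1" and t: "0 \<le> t" "t \<le> P powr (1 / m)" and P: "0 \<le> P"
    and S: "m * P powr (1 / m) \<le> S" and Q: "S\<^sup>2 \<le> m * Q"
    and IH: "S\<^sup>2 \<le> (real m - 1) * Q + m * P powr (2 / m)"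
  shows "(S + t)\<^sup>2 \<le> m * (Q + t\<^sup>2) + (real m + 1) * (P * t) powr (2 / (real m + 1))"
proof -
  define g G where "g = P powr (1 / m)" and "G = (P * t) powr (2 / (real m + 1))"
  have g2: "P powr (2 / m) = g\<^sup>2"
    by (simp add: g_def power2_eq_square flip: powr_add)
  have amgm: "2 * m * (t * g) \<le> (real m - 1) * t\<^sup>2 + (real m + 1) * G"
  proof (cases "t = 0")
    case False
    then have tp: "t > 0" using t by simp
    then have Pp: "P > 0" using t P by (cases "P = 0") auto
    \<comment> \<open>These weights sum to 1 and make the weighted geometric mean of
      \<open>t\<^sup>2\<close> and \<open>G\<close> equal to \<open>t * g\<close>.\<close>
    define \<alpha> \<beta> where "\<alpha> = (real m - 1) / (2 * m)" and "\<beta> = (real m + 1) / (2 * m)"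
    have "(t\<^sup>2) powr \<alpha> * G powr \<beta> \<le> \<alpha> * t\<^sup>2 + \<beta> * G"
      by (rule Youngs_inequality_0)
        (use m tp Pp in \<open>auto simp: \<alpha>_def \<beta>_def G_def field_simps\<close>)
    moreover have "(t\<^sup>2) powr \<alpha> = t powr ((real m - 1) / m)"
    proof -
      have "2 * \<alpha> = (real m - 1) / m" using m by (simp add: \<alpha>_def divide_simps)
      then show ?thesis
        using tp by (simp only: powr_powr flip: powr_numeral)
    qed
    moreover have "G powr \<beta> = P powr (1 / m) * t powr (1 / m)"
    proof -
      have "2 / (real m + 1) * \<beta> = 1 / m"
        using m by (simp add: \<beta>_def divide_simps)
      then show ?thesis
        using tp Pp by (simp add: G_def powr_powr powr_mult)
    qed
    moreover have "t powr ((real m - 1) / m) * t powr (1 / m) = t"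
    proof -
      have "(real m - 1) / m + 1 / m = 1" using m by (simp add: field_simps)
      then show ?thesis using tp by (simp flip: powr_add)
    qed
    ultimately have "t * g \<le> \<alpha> * t\<^sup>2 + \<beta> * G"
      by (simp add: g_def mult_ac)
    then have "2 * m * (t * g) \<le> 2 * m * (\<alpha> * t\<^sup>2 + \<beta> * G)"
      by (intro mult_left_mono) auto
    also have "\<dots> = (real m - 1) * t\<^sup>2 + (real m + 1) * G"
      using m by (simp add: \<alpha>_def \<beta>_def distrib_left)
    finally show ?thesis .
  qed (simp add: G_def)
  \<comment> \<open>Since \<open>t\<close> \<le> \<open>g\<close> \<le> \<open>S / m\<close>, the
    sum of \<open>S - m * t\<close> and \<open>m * g - m * t\<close> is nonnegative, and so is its
    product with \<open>S - m * g\<close>; expanding this product bounds the first part of the cross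
    term.\<close>
  have "m * t \<le> m * g" "m * g \<le> S"
    using t S by (simp_all add: g_def mult_left_mono)
  then have "0 \<le> (S - m * g) * (S + m * g - 2 * m * t)"
    by (intro mult_nonneg_nonneg) linarith+
  then have "2 * m * t * (S - m * g) \<le> S\<^sup>2 - (m * g)\<^sup>2"
    by (simp add: power2_eq_square algebra_simps)
  also have "\<dots> \<le> m * (Q - m * g\<^sup>2)"
    using Q by (simp add: power2_eq_square algebra_simps)
  finally have "m * (2 * t * (S - m * g)) \<le> m * (Q - m * g\<^sup>2)"
    by (simp add: mult_ac)
  then have "2 * t * (S - m * g) \<le> Q - m * g\<^sup>2"
    using m by simp
  then show ?thesis
    using amgm IH unfolding g2 G_def[symmetric]
    by (simp add: power2_eq_square algebra_simps)
qed

theorem Kober_inequality: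
  fixes x :: "'a \<Rightarrow> real"
  assumes "finite A" "A \<noteq> {}" "\<And>i. i \<in> A \<Longrightarrow> 0 \<le> x i"
  shows "(\<Sum>i\<in>A. x i)\<^sup>2
    \<le> (real (card A) - 1) * (\<Sum>i\<in>A. (x i)\<^sup>2) + card A * (\<Prod>i\<in>A. x i) powr (2 / card A)"
  using assms
proof (induction "card A" arbitrary: A)
  case 0
  then show ?case by simp
next
  case (Suc m)
  \<comment> \<open>Choosing the smallest variable guarantees that it is at most the geometric mean
    of the others, as \<open>Kober_step\<close> requires.\<close>
  obtain k where k: "k \<in> A" "\<And>i. i \<in> A \<Longrightarrow> x k \<le> x i"
    using finite_has_minimal[of "x ` A"] Suc.prems
    by (metis (mono_tags, lifting) arg_min_if_finite(1) arg_min_least)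
  define B where "B = A - {k}"
  have B: "finite B" "k \<notin> B" "A = insert k B" "card B = m"
    using Suc.hyps(2) Suc.prems k(1) by (auto simp: B_def)
  have nonneg: "0 \<le> x i" if "i \<in> A" for i using Suc.prems that by blast
  show ?case
  proof (cases "m = 0")
    case True
    then show ?thesis using B nonneg[of k] by simp
  next
    case False
    then have Bne: "B \<noteq> {}" using B by auto
    let ?P = "\<Prod>i\<in>B. x i" and ?S = "\<Sum>i\<in>B. x i" and ?Q = "\<Sum>i\<in>B. (x i)\<^sup>2"
    have P: "0 \<le> ?P" using nonneg B by (intro prod_nonneg) auto
    have "x k ^ m \<le> ?P"
      using prod_mono[of B "\<lambda>_. x k" x] k B nonneg by simp
    then have "(x k ^ m) powr (1 / m) \<le> ?P powr (1 / m)"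
      using nonneg[OF k(1)] by (intro powr_mono2) auto
    then have t: "x k \<le> ?P powr (1 / m)"
      using nonneg[OF k(1)] False by (cases "x k = 0") (auto simp: powr_powr simp flip: powr_realpow)
    have "?P powr (1 / m) \<le> ?S / m"
      using arith_geom_mean[of B x] B Bne nonneg by (simp add: sum_divide_distrib)
    then have S: "m * ?P powr (1 / m) \<le> ?S"
      using False by (simp add: field_simps)
    have Q: "?S\<^sup>2 \<le> m * ?Q"
      using sum_squared_le_sum_of_squares[of x B] B by (simp add: mult.commute)
    have IH: "?S\<^sup>2 \<le> (real m - 1) * ?Q + m * ?P powr (2 / m)"
      using Suc.hyps(1)[of B] B Bne nonneg by auto
    have "(?S + x k)\<^sup>2 \<le> m * (?Q + (x k)\<^sup>2) + (real m + 1) * (?P * x k) powr (2 / (real m + 1))"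
      using False nonneg[OF k(1)] t P S Q IH by (intro Kober_step) auto
    then show ?thesis
      using B by (simp add: add_ac mult_ac)
  qed
qed

section \<open>Pure states\<close>

text \<open>All amplitudes of \<open>max_coherent\<close> are equal, so the overlap is a scaled sum
  of the amplitudes of \<open>\<psi>\<close>. The triangle inequality discards their phases and
  leaves the moduli to which Kober's inequality applies.\<close>

lemma cmod_cinner_max_coherent:
  fixes \<psi> :: "complex ^ 'n"
  shows "(cmod (cinner max_coherent \<psi>))\<^sup>2 \<le> (\<Sum>i\<in>UNIV. cmod (\<psi> $ i))\<^sup>2 / CARD('n)"
proof -
  have "cinner max_coherent \<psi> = (\<Sum>i\<in>UNIV. \<psi> $ i) / complex_of_real (sqrt CARD('n))"
    by (simp add: cinner_def max_coherent_def sum_divide_distrib)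
  then have "cmod (cinner max_coherent \<psi>) = cmod (\<Sum>i\<in>UNIV. \<psi> $ i) / sqrt CARD('n)"
    by (simp add: norm_divide)
  also have "\<dots> \<le> (\<Sum>i\<in>UNIV. cmod (\<psi> $ i)) / sqrt CARD('n)"
    by (intro divide_right_mono norm_sum) simp
  finally have "(cmod (cinner max_coherent \<psi>))\<^sup>2 \<le> ((\<Sum>i\<in>UNIV. cmod (\<psi> $ i)) / sqrt CARD('n))\<^sup>2"
    by (intro power_mono) auto
  then show ?thesis by (simp add: power_divide)
qed

lemma G_coherence_pure_nonneg: "0 \<le> G_coherence_pure \<psi>"
  by (simp add: G_coherence_pure_def)

text \<open>This is Kober's inequality for the moduli of the amplitudes: normalization turns the sum
  of squares into 1, and the product term is exactly \<open>G_coherence_pure \<psi>\<close>.\<close>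

lemma G_coherence_pure_ge:
  fixes \<psi> :: "complex ^ 'n"
  assumes "pure_state \<psi>"
  shows "1 - real CARD('n) * (1 - (cmod (cinner max_coherent \<psi>))\<^sup>2) \<le> G_coherence_pure \<psi>"
proof -
  have "(\<Sum>i\<in>UNIV. (cmod (\<psi> $ i))\<^sup>2) = 1"
    using assms by (simp add: pure_state_def norm_vec_def L2_set_def)
  then have "(\<Sum>i\<in>UNIV. cmod (\<psi> $ i))\<^sup>2 \<le> (real CARD('n) - 1) + G_coherence_pure \<psi>"
    using Kober_inequality[of UNIV "\<lambda>i. cmod (\<psi> $ i)"]
    by (simp add: G_coherence_pure_def prod_norm)
  moreover have "CARD('n) * (cmod (cinner max_coherent \<psi>))\<^sup>2 \<le> (\<Sum>i\<in>UNIV. cmod (\<psi> $ i))\<^sup>2"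
    using cmod_cinner_max_coherent[of \<psi>] by (simp add: field_simps)
  ultimately show ?thesis by (simp add: algebra_simps)
qed

lemma cinner_ketbra:
  "cinner v (ketbra w *v v) = complex_of_real ((cmod (cinner v w))\<^sup>2)"
proof -
  have "cinner v (ketbra w *v v) = cinner v w * (\<Sum>j\<in>UNIV. cnj (w $ j) * v $ j)"
    by (simp add: cinner_def ketbra_def matrix_vector_mult_def sum_distrib_left sum_distrib_right
        mult_ac)
  also have "(\<Sum>j\<in>UNIV. cnj (w $ j) * v $ j) = cnj (cinner v w)"
    by (simp add: cinner_def mult_ac)
  finally show ?thesis by (simp only: complex_norm_square)
qed

lemma Re_cinner_sum_mult:
  fixes A :: "'k \<Rightarrow> complex ^ 'n ^ 'n"
  shows "Re (cinner v ((\<Sum>k\<in>I. c k *\<^sub>R A k) *v v)) = (\<Sum>k\<in>I. c k * Re (cinner v (A k *v v)))"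
proof (induction I rule: infinite_finite_induct)
  case (insert k I)
  have "cinner v ((c k *\<^sub>R A k + B) *v v) = c k *\<^sub>R cinner v (A k *v v) + cinner v (B *v v)" for B
    by (simp add: cinner_def matrix_vector_mult_def scaleR_sum_right sum.distrib algebra_simps
        sum_distrib_left)
  with insert show ?case by simp
qed (simp_all add: cinner_def)

lemma roof_values_G_ge:
  fixes \<rho> :: "complex ^ 'n ^ 'n"
  assumes "v \<in> roof_values G_coherence_pure \<rho>"
  shows "max (1 - real CARD('n) * (1 - Re (cinner max_coherent (\<rho> *v max_coherent)))) 0 \<le> v"
proof -
  obtain m p \<psi> where dec: "pure_decomposition \<rho> m p \<psi>"
    and v: "v = (\<Sum>k<m. p k * G_coherence_pure (\<psi> k))"
    using assms unfolding roof_values_def by blast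
  have p: "0 \<le> p k" "pure_state (\<psi> k)" if "k < m" for k
    using dec that by (auto simp: pure_decomposition_def)
  have p1: "(\<Sum>k<m. p k) = 1" and \<rho>: "\<rho> = (\<Sum>k<m. p k *\<^sub>R ketbra (\<psi> k))"
    using dec by (auto simp: pure_decomposition_def)
  let ?f = "\<lambda>k. (cmod (cinner max_coherent (\<psi> k)))\<^sup>2"
  \<comment> \<open>Replacing both constants 1 by the sum of the weights makes the bound an average
    of pure-state bounds.\<close>
  have "1 - real CARD('n) * (1 - Re (cinner max_coherent (\<rho> *v max_coherent)))
    = (\<Sum>k<m. p k) - real CARD('n) * ((\<Sum>k<m. p k) - (\<Sum>k<m. p k * ?f k))"
    unfolding \<rho> Re_cinner_sum_mult cinner_ketbra p1 by simp
  also have "\<dots> = (\<Sum>k<m. p k * (1 - real CARD('n) * (1 - ?f k)))"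
    by (simp add: algebra_simps sum.distrib sum_subtractf sum_distrib_left)
  also have "\<dots> \<le> v"
    unfolding v using p G_coherence_pure_ge by (intro sum_mono mult_left_mono) auto
  finally show ?thesis
    unfolding v using p G_coherence_pure_nonneg by (auto intro!: sum_nonneg mult_nonneg_nonneg)
qed

section \<open>Existence of pure-state decompositions\<close>

text \<open>A density matrix without the trace condition, which is lost once a rank-one term is
  subtracted.\<close>

definition positive_semidefinite :: "complex ^ 'n ^ 'n \<Rightarrow> bool" where
  "positive_semidefinite A \<longleftrightarrow> hermitian A \<and> (\<forall>v. 0 \<le> Re (cinner v (A *v v)))"

lemma hermitian_diag: "hermitian A \<Longrightarrow> A $ k $ k = complex_of_real (Re (A $ k $ k))"
  by (metis Reals_cnj_iff hermitian_def of_real_Re)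

text \<open>Varying one coordinate makes the form a quadratic polynomial in \<open>c\<close>;
  suitable choices of \<open>c\<close> give both the vanishing of rows with zero pivot and the
  positivity of Schur complements.\<close>

lemma cinner_add_axis:
  fixes A :: "complex ^ 'n ^ 'n"
  assumes "hermitian A"
  defines "z \<equiv> \<lambda>v k. (A *v v) $ k"
  shows "Re (cinner (v + axis k c) (A *v (v + axis k c)))
    = Re (cinner v (A *v v)) + 2 * Re (cnj c * z v k) + (cmod c)\<^sup>2 * Re (A $ k $ k)"
proof -
  have A_axis: "(A *v axis k c) $ i = A $ i $ k * c" for i
    by (simp add: matrix_vector_mult_def axis_def if_distrib cong: if_cong)
  have left: "cinner (axis k c) w = cnj c * w $ k" for w
    by (simp add: cinner_def axis_def if_distrib[of cnj] if_distrib[of "\<lambda>x. x * _"] cong: if_cong)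
  have right: "cinner v (A *v axis k c) = cnj (cnj c * z v k)"
  proof -
    have "cnj (A $ k $ j) = A $ j $ k" for j
      using assms(1) by (metis hermitian_def)
    then show ?thesis
      unfolding z_def cinner_def A_axis
      by (simp add: matrix_vector_mult_def sum_distrib_left mult_ac)
  qed
  have "cinner (v + axis k c) (A *v (v + axis k c))
    = cinner v (A *v v) + cinner v (A *v axis k c)
      + (cinner (axis k c) (A *v v) + cinner (axis k c) (A *v axis k c))"
    by (simp add: cinner_def matrix_vector_right_distrib algebra_simps sum.distrib)
  moreover have "cinner (axis k c) (A *v axis k c) = complex_of_real ((cmod c)\<^sup>2 * Re (A $ k $ k))"
    unfolding left A_axis using hermitian_diag[OF assms(1), of k]
    by (metis complex_norm_square mult.assoc mult.commute of_real_mult)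
  ultimately show ?thesis
    unfolding right left z_def by simp
qed

text \<open>With a zero pivot the quadratic term in \<open>c\<close> disappears, so a nonzero entry
  in row \<open>k\<close> would let the form decrease linearly without bound.\<close>

lemma psd_zero_diag:
  fixes A :: "complex ^ 'n ^ 'n"
  assumes "positive_semidefinite A" "A $ k $ k = 0"
  shows "A $ k $ j = 0"
proof -
  define z where "z = A $ k $ j"
  define q where "q = Re (cinner (axis j 1) (A *v axis j 1))"
  have z: "(A *v axis j 1) $ k = z"
    by (simp add: z_def matrix_vector_mult_def axis_def if_distrib cong: if_cong)
  have "0 \<le> q - 2 * r * (cmod z)\<^sup>2" for r :: real
  proof -
    have "Re (cnj (complex_of_real (- r) * z) * z) = - r * (cmod z)\<^sup>2"
      by (simp add: cmod_def power2_eq_square algebra_simps)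
    moreover have "0 \<le> q + 2 * Re (cnj (complex_of_real (- r) * z) * z)
      + (cmod (complex_of_real (- r) * z))\<^sup>2 * Re (A $ k $ k)"
      using assms(1) unfolding positive_semidefinite_def q_def z[symmetric]
      by (subst cinner_add_axis[symmetric]) blast+
    ultimately show ?thesis
      unfolding assms(2) by (simp only: zero_complex.sel)
  qed
  \<comment> \<open>For \<open>z\<close> nonzero, this value of \<open>r\<close> turns the lower
    bound into \<open>0 \<le> -1\<close>.\<close>
  from this[of "(q + 1) / (2 * (cmod z)\<^sup>2)"] show ?thesis
    by (cases "z = 0") (auto simp: z_def)
qed

text \<open>The vector \<open>w\<close> is column \<open>k\<close> divided by the root of the pivot,
  so \<open>ketbra w\<close> reproduces row \<open>k\<close>. The remainder stays positive because
  its form at \<open>v\<close> is a value of the form of \<open>A\<close> at a shifted vector. The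
  last conclusion keeps rows that were cleared earlier equal to zero.\<close>

lemma psd_Schur_complement:
  fixes A :: "complex ^ 'n ^ 'n"
  assumes "positive_semidefinite A" "A $ k $ k \<noteq> 0"
  obtains w where "positive_semidefinite (A - ketbra w)" "(A - ketbra w) $ k = 0"
    "\<And>i. A $ i = 0 \<Longrightarrow> (A - ketbra w) $ i = 0"
proof -
  define a where "a = Re (A $ k $ k)"
  have herm: "hermitian A" and pos: "0 \<le> Re (cinner v (A *v v))" for v
    using assms(1) by (auto simp: positive_semidefinite_def)
  have Akk: "A $ k $ k = complex_of_real a"
    using hermitian_diag[OF herm] by (simp add: a_def)
  have "0 \<le> a"
    using pos[of "axis k 1"] cinner_add_axis[OF herm, of 0 k 1] by (simp add: a_def cinner_def)
  then have a: "a > 0" using assms(2) Akk by (cases "a = 0") auto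
  define w where "w = (\<chi> i. A $ i $ k / complex_of_real (sqrt a))"
  have sq: "complex_of_real (sqrt a) * complex_of_real (sqrt a) = complex_of_real a"
    using a by (simp flip: of_real_mult)
  have ent: "(A - ketbra w) $ i $ j = A $ i $ j - A $ i $ k * A $ k $ j / complex_of_real a" for i j
  proof -
    have "cnj (A $ j $ k) = A $ k $ j" using herm by (metis hermitian_def)
    then show ?thesis by (simp add: w_def ketbra_def sq)
  qed
  have "0 \<le> Re (cinner v ((A - ketbra w) *v v))" for v
  proof -
    define z where "z = (A *v v) $ k"
    have "cnj (cinner v w) = z / complex_of_real (sqrt a)"
    proof -
      have "cnj (A $ i $ k) = A $ k $ i" for i using herm by (metis hermitian_def)
      then show ?thesis
        by (simp add: cinner_def w_def z_def matrix_vector_mult_def sum_divide_distrib mult_ac)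
    qed
    then have "(cmod (cinner v w))\<^sup>2 = (cmod z)\<^sup>2 / a"
      using a by (metis abs_of_nonneg complex_mod_cnj norm_divide norm_of_real power_divide
          less_imp_le real_sqrt_ge_zero real_sqrt_pow2)
    then have "Re (cinner v ((A - ketbra w) *v v)) = Re (cinner v (A *v v)) - (cmod z)\<^sup>2 / a"
      using cinner_ketbra[of v w]
      by (simp add: matrix_vector_mult_diff_rdistrib cinner_def algebra_simps sum_subtractf)
    \<comment> \<open>Completing the square: the shift \<open>c = - z / a\<close> minimizes the
      quadratic polynomial of \<open>cinner_add_axis\<close>.\<close>
    also have "\<dots> = Re (cinner v (A *v v)) + 2 * Re (cnj (- z / complex_of_real a) * z)
      + (cmod (- z / complex_of_real a))\<^sup>2 * a"
    proof -
      have "Re (cnj (- z / complex_of_real a) * z) = - ((cmod z)\<^sup>2 / a)"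
        using cmod_power2[of z] by (simp add: power2_eq_square add_divide_distrib)
      moreover have "(cmod (- z / complex_of_real a))\<^sup>2 * a = (cmod z)\<^sup>2 / a"
        using a by (simp add: norm_divide power_divide power2_eq_square)
      ultimately show ?thesis by (simp only:)
    qed
    also have "\<dots> \<ge> 0"
      using cinner_add_axis[OF herm, of v k "- z / complex_of_real a"] pos
      by (metis a_def z_def)
    finally show ?thesis .
  qed
  moreover have "hermitian (A - ketbra w)"
  proof -
    have "cnj (A $ j $ i) = A $ i $ j" for i j using herm by (metis hermitian_def)
    then show ?thesis by (simp add: hermitian_def ketbra_def mult.commute)
  qed
  ultimately have "positive_semidefinite (A - ketbra w)"
    by (simp add: positive_semidefinite_def)
  moreover have "(A - ketbra w) $ k = 0"
    using a by (simp add: vec_eq_iff ent[simplified] Akk)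
  moreover have "(A - ketbra w) $ i = 0" if "A $ i = 0" for i
    using that by (simp add: vec_eq_iff ent[simplified])
  ultimately show thesis using that by blast
qed

text \<open>The set \<open>S\<close> holds the rows that may still be nonzero; each elimination step
  removes one of them at the cost of one rank-one term.\<close>

lemma psd_sum_ketbra:
  fixes A :: "complex ^ 'n ^ 'n"
  assumes "finite S" "positive_semidefinite A" "\<And>i. i \<notin> S \<Longrightarrow> A $ i = 0"
  shows "\<exists>w. A = (\<Sum>k\<in>S. ketbra (w k))"
  using assms
proof (induction S arbitrary: A)
  case empty
  then show ?case by (simp add: vec_eq_iff)
next
  case (insert k S)
  obtain u where u: "positive_semidefinite (A - ketbra u)" "(A - ketbra u) $ k = 0"
    "\<And>i. A $ i = 0 \<Longrightarrow> (A - ketbra u) $ i = 0"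
  \<comment> \<open>With a zero pivot the whole row is already zero, and the zero vector serves as
    \<open>u\<close>.\<close>
  proof (cases "A $ k $ k = 0")
    case True
    then have "A $ k = 0"
      using psd_zero_diag[OF insert.prems(1)] by (simp add: vec_eq_iff)
    moreover have "ketbra (0 :: complex ^ 'n) = 0"
      by (simp add: ketbra_def vec_eq_iff)
    ultimately show thesis
      using that[of 0] insert.prems(1) by simp
  next
    case False
    then show thesis
      using psd_Schur_complement[OF insert.prems(1)] that by blast
  qed
  have "\<And>i. i \<notin> S \<Longrightarrow> (A - ketbra u) $ i = 0"
    using u insert.prems(2) by (metis insert_iff)
  then obtain w where w: "A - ketbra u = (\<Sum>i\<in>S. ketbra (w i))"
    using insert.IH u(1) by blast
  have "A = (\<Sum>i\<in>insert k S. ketbra ((w(k := u)) i))"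
    using w insert.hyps by (auto simp: algebra_simps intro!: sum.cong)
  then show ?case by blast
qed

lemma trace_ketbra: "trace (ketbra w) = complex_of_real ((norm w)\<^sup>2)"
  unfolding norm_eq_cinner by (simp add: trace_def ketbra_def cinner_def mult.commute)

text \<open>The unnormalized vectors are rescaled, their squared norms become the weights, and unit
  trace makes these weights sum to 1.\<close>

lemma ex_pure_decomposition:
  fixes \<rho> :: "complex ^ 'n ^ 'n"
  assumes "density_matrix \<rho>"
  shows "\<exists>m p \<psi>. pure_decomposition \<rho> m p \<psi>"
proof -
  obtain w' :: "'n \<Rightarrow> complex ^ 'n" where w': "\<rho> = (\<Sum>k\<in>UNIV. ketbra (w' k))"
    using psd_sum_ketbra[of UNIV \<rho>] assms
    by (auto simp: density_matrix_def positive_semidefinite_def)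
  \<comment> \<open>Decompositions are indexed by naturals, so the terms are renumbered along a
    bijection.\<close>
  obtain h :: "nat \<Rightarrow> 'n" where h: "bij_betw h {..<CARD('n)} UNIV"
    using ex_bij_betw_nat_finite[of "UNIV :: 'n set"] by (auto simp: atLeast0LessThan)
  define w where "w = w' \<circ> h"
  have \<rho>: "\<rho> = (\<Sum>k<CARD('n). ketbra (w k))"
    unfolding w' w_def using sum.reindex_bij_betw[OF h] by (metis (no_types) comp_apply sum.cong)
  define p where "p = (\<lambda>k. (norm (w k))\<^sup>2)"
  \<comment> \<open>A zero vector carries weight 0, so an arbitrary basis vector can take its place
    as a pure state.\<close>
  define \<psi> where "\<psi> = (\<lambda>k. if w k = 0 then axis undefined 1 else w k /\<^sub>R norm (w k))"
  have "trace (\<Sum>k\<in>I. ketbra (w k)) = complex_of_real (\<Sum>k\<in>I. p k)" for I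
    by (induction I rule: infinite_finite_induct)
      (simp_all add: trace_add trace_ketbra p_def trace_0[unfolded mat_0])
  then have "(\<Sum>k<CARD('n). p k) = 1"
    using assms \<rho> by (metis density_matrix_def of_real_eq_1_iff)
  moreover have "p k *\<^sub>R ketbra (\<psi> k) = ketbra (w k)" for k
    by (simp add: p_def \<psi>_def ketbra_def vec_eq_iff power2_eq_square)
       (simp add: scaleR_conv_of_real field_simps)
  moreover have "0 \<le> p k" "pure_state (\<psi> k)" for k
    by (simp_all add: p_def \<psi>_def pure_state_def norm_axis_1)
  ultimately have "pure_decomposition \<rho> CARD('n) p \<psi>"
    unfolding pure_decomposition_def using \<rho> by simp
  then show ?thesis by blast
qed

theorem corollary1:
  fixes \<rho> :: "complex ^ 'n ^ 'n" and K :: real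
  assumes "CARD('n) \<ge> 2"
    and "density_matrix \<rho>"
    and "K = Re (cinner max_coherent (\<rho> *v max_coherent))"
  shows "G_coherence \<rho> \<ge> max (1 - real CARD('n) * (1 - K)) 0"
proof -
  \<comment> \<open>A lower bound of all elements bounds the real infimum only for a nonempty
    set.\<close>
  have "roof_values G_coherence_pure \<rho> \<noteq> {}"
    using ex_pure_decomposition[OF assms(2)] unfolding roof_values_def by blast
  then show ?thesis
    unfolding G_coherence_def convex_roof_def assms(3)
    using roof_values_G_ge by (rule cInf_greatest)
qed

end
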